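(* Assume there is a constant $c_I>0$ such that $$\inf_{v^h\in\mathcal U^h}\ \sup_{w\in\mathcal Z^{\mathfrak h}}\frac{|\langle v^h,L^*w\rangle|}{\|v^h\|\,\|L^*w\|}\ \ge\ c_I .$$ Let $f\in L^2(\Omega)$, let $\hat u\in\mathcal D(L)$ be the exact solution of $Lu=f$, and let $u^h\in\mathcal U^h$ be the approximation obtained by the $(\mathcal L\mathcal L^* )^{-1}$ method, i.e. the solution of any of the equivalent problems (a)--(d) listed in the context. Then $$\|u^h-\hat u\|\le\Big(1+\frac1{c_I}\Big)\inf_{v^h\in\mathcal U^h}\|v^h-\hat u\| .$$
   Context: $\Omega\subset\mathbb R^d$ is a domain; $L^2(\Omega)$ (real-valued) has norm $\|\cdot\|$ and inner product $\langle\cdot,\cdot\rangle$. $L$ is a linear first-order differential operator, regarded as a closed, densely defined unbounded linear operator in $L^2(\Omega)$ with domain $\mathcal D(L)$ (the functions $u\in L^2(\Omega)$ with $Lu\in L^2(\Omega)$ satisfying given homogeneous boundary conditions). $L^*$ with domain $\mathcal D(L^* )$ is its $L^2(\Omega)$-adjoint. Standing assumptions: (i) there is $c_P^*>0$ with $c_P^*\|w\|\le\|L^*w\|$ for all $w\in\mathcal D(L^* )$; (ii) $L^*(\mathcal D(L^* ))=L^2(\Omega)$. (These imply that $Lu=f$ has a unique solution $\hat u\in\mathcal D(L)$ for each $f\in L^2(\Omega)$.) $\mathcal U^h\subset\mathcal D(L)$ and $\mathcal Z^{\mathfrak h}\subset\mathcal D(L^* )$ are (nonzero, finite-dimensional)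 finite element spaces. In infima and suprema of quotients only nonzero elements are considered. For $q\in L^2(\Omega)$, $(L_wL^* )^{-1}_{\mathfrak h}q\in\mathcal Z^{\mathfrak h}$ denotes the unique $z\in\mathcal Z^{\mathfrak h}$ with $\langle L^*z,L^*w\rangle=\langle q,w\rangle$ for all $w\in\mathcal Z^{\mathfrak h}$. $\Pi^{\mathfrak h}_*$ is the $L^2$-orthogonal projection of $L^2(\Omega)$ onto $L^*(\mathcal Z^{\mathfrak h})$. The $(\mathcal L\mathcal L^* )^{-1}$ method is given by any of the following equivalent problems for $u^h\in\mathcal U^h$: (a) $u^h$ minimizes $\langle (L_wL^* )^{-1}_{\mathfrak h}(Lv^h-f),\,Lv^h-f\rangle$ over $v^h\in\mathcal U^h$; equivalently $\langle (L_wL^* )^{-1}_{\mathfrak h}Lu^h,Lv^h\rangle=\langle (L_wL^* )^{-1}_{\mathfrak h}f,Lv^h\rangle$ for all $v^h\in\mathcal U^h$. (b) $u^h$ is the first component of $(u^h,z)\in\mathcal U^h\times\mathcal Z^{\mathfrak h}$ satisfying $\langle L^*z,L^*w\rangle+\langle u^h,L^*w\rangle=\langle f,w\rangle$ for all $w\in\mathcal Z^{\mathfrak h}$ and $\langle L^*z,v^h\rangle=0$ for all $v^h\in\mathcal U^h$. (c) $u^h$ minimizes $\|\Pi^{\mathfrak h}_*(v^h-\hat u)\|^2$ over $v^h\in\mathcal U^h$. (d) $\langle\Pi^{\mathfrak h}_*u^h,v^h\rangle=\langle\Pi^{\mathfrak h}_*\hat u,v^h\rangle$ for all $v^h\in\mathcal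 U^h$. *)

theory Defs
  imports "HOL-Analysis.Analysis"
begin

section \<open>The space of square-integrable functions\<close>

text \<open>Elements of the real space $L^2(S)$ are represented by functions; the values off \<open>S\<close> are
  irrelevant, and equality in $L^2(S)$ is \<open>L2_eq S\<close>, i.e. equality almost everywhere on \<open>S\<close>.\<close>

definition L2_space :: "'a::euclidean_space set \<Rightarrow> ('a \<Rightarrow> real) set" where
  "L2_space S = {u. u \<in> borel_measurable (lebesgue_on S) \<and> integrable (lebesgue_on S) (\<lambda>x. (u x)\<^sup>2)}"

definition L2_eq :: "'a::euclidean_space set \<Rightarrow> ('a \<Rightarrow> real) \<Rightarrow> ('a \<Rightarrow> real) \<Rightarrow> bool" where
  "L2_eq S u v \<longleftrightarrow> (AE x in lebesgue_on S. u x = v x)"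

definition L2_inner :: "'a::euclidean_space set \<Rightarrow> ('a \<Rightarrow> real) \<Rightarrow> ('a \<Rightarrow> real) \<Rightarrow> real" where
  "L2_inner S u v = integral\<^sup>L (lebesgue_on S) (\<lambda>x. u x * v x)"

definition L2_norm :: "'a::euclidean_space set \<Rightarrow> ('a \<Rightarrow> real) \<Rightarrow> real" where
  "L2_norm S u = sqrt (L2_inner S u u)"

definition L2_zero :: "'a::euclidean_space set \<Rightarrow> ('a \<Rightarrow> real) \<Rightarrow> bool" where
  "L2_zero S u \<longleftrightarrow> L2_eq S u (\<lambda>_. 0)"

definition fun_subspace :: "('a \<Rightarrow> real) set \<Rightarrow> bool" where
  "fun_subspace V \<longleftrightarrow>
     (\<lambda>_. 0) \<in> V \<and>
     (\<forall>u\<in>V. \<forall>v\<in>V. (\<lambda>x. u x + v x) \<in> V) \<and>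
     (\<forall>c. \<forall>u\<in>V. (\<lambda>x. c * u x) \<in> V)"

section \<open>Unbounded operators\<close>

text \<open>An unbounded operator is a pair of a domain \<open>D\<close> and a map \<open>L\<close> on representatives (arbitrary
  outside \<open>D\<close>), both compatible with equality almost everywhere.\<close>

definition linear_operator ::
    "'a::euclidean_space set \<Rightarrow> ('a \<Rightarrow> real) set \<Rightarrow> (('a \<Rightarrow> real) \<Rightarrow> 'a \<Rightarrow> real) \<Rightarrow> bool" where
  "linear_operator S D L \<longleftrightarrow>
     D \<subseteq> L2_space S \<and> fun_subspace D \<and> L ` D \<subseteq> L2_space S \<and>
     (\<forall>u\<in>D. \<forall>v\<in>L2_space S. L2_eq S u v \<longrightarrow> v \<in> D \<and> L2_eq S (L u) (L v)) \<and>
     (\<forall>u\<in>D. \<forall>v\<in>D. L2_eq S (L (\<lambda>x. u x + v x)) (\<lambda>x. L u x + L v x)) \<and>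
     (\<forall>c. \<forall>u\<in>D. L2_eq S (L (\<lambda>x. c * u x)) (\<lambda>x. c * L u x))"

definition densely_defined :: "'a::euclidean_space set \<Rightarrow> ('a \<Rightarrow> real) set \<Rightarrow> bool" where
  "densely_defined S D \<longleftrightarrow>
     (\<forall>g\<in>L2_space S. \<forall>e>0. \<exists>u\<in>D. L2_norm S (\<lambda>x. u x - g x) < e)"

definition closed_operator ::
    "'a::euclidean_space set \<Rightarrow> ('a \<Rightarrow> real) set \<Rightarrow> (('a \<Rightarrow> real) \<Rightarrow> 'a \<Rightarrow> real) \<Rightarrow> bool" where
  "closed_operator S D L \<longleftrightarrow>
     (\<forall>U. \<forall>u\<in>L2_space S. \<forall>g\<in>L2_space S.
        (\<forall>n::nat. U n \<in> D) \<and>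
        (\<lambda>n. L2_norm S (\<lambda>x. U n x - u x)) \<longlonglongrightarrow> 0 \<and>
        (\<lambda>n. L2_norm S (\<lambda>x. L (U n) x - g x)) \<longlonglongrightarrow> 0
        \<longrightarrow> u \<in> D \<and> L2_eq S (L u) g)"

definition adj_dom ::
    "'a::euclidean_space set \<Rightarrow> ('a \<Rightarrow> real) set \<Rightarrow> (('a \<Rightarrow> real) \<Rightarrow> 'a \<Rightarrow> real) \<Rightarrow> ('a \<Rightarrow> real) set" where
  "adj_dom S D L =
     {w \<in> L2_space S. \<exists>g\<in>L2_space S. \<forall>u\<in>D. L2_inner S (L u) w = L2_inner S u g}"

text \<open>For densely defined \<open>L\<close> the chosen representative is unique up to equality almost everywhere.\<close>

definition adj ::
    "'a::euclidean_space set \<Rightarrow> ('a \<Rightarrow> real) set \<Rightarrow> (('a \<Rightarrow> real) \<Rightarrow> 'a \<Rightarrow> real) \<Rightarrow> ('a \<Rightarrow> real) \<Rightarrow> 'a \<Rightarrow> real"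
  where
  "adj S D L w =
     (SOME g. g \<in> L2_space S \<and> (\<forall>u\<in>D. L2_inner S (L u) w = L2_inner S u g))"

section \<open>First-order differential operators\<close>

fun C_k :: "nat \<Rightarrow> ('a::euclidean_space \<Rightarrow> real) \<Rightarrow> bool" where
  "C_k 0 \<phi> \<longleftrightarrow> continuous_on UNIV \<phi>"
| "C_k (Suc k) \<phi> \<longleftrightarrow>
     (\<forall>x. \<phi> differentiable (at x)) \<and> (\<forall>v. C_k k (\<lambda>x. frechet_derivative \<phi> (at x) v))"

definition test_functions :: "'a::euclidean_space set \<Rightarrow> ('a \<Rightarrow> real) set" where
  "test_functions S =
     {\<phi>. (\<forall>k. C_k k \<phi>) \<and> compact (closure {x. \<phi> x \<noteq> 0}) \<and> closure {x. \<phi> x \<noteq> 0} \<subseteq> S}"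

text \<open>\<open>L u\<close> is understood in the sense of distributions: the formal adjoint of \<open>L\<close> is
  $\varphi \mapsto \alpha\cdot\nabla\varphi + \beta\varphi$. The operator $Lu = a\cdot\nabla u + bu$ has
  $\alpha = -a$ and $\beta = b - \mathrm{div}\, a$. The only regularity asked of the coefficients is that
  the formal adjoint maps test functions into $L^2(S)$, so that the pairing with \<open>u\<close> makes sense.
  Homogeneous boundary conditions are carried by the choice of the domain \<open>D\<close>.\<close>

definition first_order_differential_operator ::
    "'a::euclidean_space set \<Rightarrow> ('a \<Rightarrow> real) set \<Rightarrow> (('a \<Rightarrow> real) \<Rightarrow> 'a \<Rightarrow> real) \<Rightarrow> bool" where
  "first_order_differential_operator S D L \<longleftrightarrow>
     (\<exists>(\<alpha> :: 'a \<Rightarrow> 'a) (\<beta> :: 'a \<Rightarrow> real). \<forall>\<phi>\<in>test_functions S.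
        (\<lambda>x. frechet_derivative \<phi> (at x) (\<alpha> x) + \<beta> x * \<phi> x) \<in> L2_space S \<and>
        (\<forall>u\<in>D. L2_inner S (L u) \<phi> =
                L2_inner S u (\<lambda>x. frechet_derivative \<phi> (at x) (\<alpha> x) + \<beta> x * \<phi> x)))"

section \<open>Discrete spaces\<close>

text \<open>\<open>V\<close> need not be closed under equality almost everywhere, so it may consist of, e.g., honest
  piecewise polynomials as well as of all their representatives.\<close>

definition discrete_space ::
    "'a::euclidean_space set \<Rightarrow> ('a \<Rightarrow> real) set \<Rightarrow> ('a \<Rightarrow> real) set \<Rightarrow> bool" where
  "discrete_space S D V \<longleftrightarrow>
     V \<subseteq> D \<and> fun_subspace V \<and> (\<exists>v\<in>V. \<not> L2_zero S v) \<and>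
     (\<exists>B. finite B \<and> B \<subseteq> V \<and> (\<forall>v\<in>V. \<exists>c. L2_eq S v (\<lambda>x. \<Sum>b\<in>B. c b * b x)))"

text \<open>\<open>Ls\<close> is the adjoint operator and \<open>Z\<close> the discrete subspace of its domain.\<close>

definition LwLs_inv ::
    "'a::euclidean_space set \<Rightarrow> (('a \<Rightarrow> real) \<Rightarrow> 'a \<Rightarrow> real) \<Rightarrow> ('a \<Rightarrow> real) set \<Rightarrow> ('a \<Rightarrow> real) \<Rightarrow> 'a \<Rightarrow> real"
  where
  "LwLs_inv S Ls Z q =
     (SOME z. z \<in> Z \<and> (\<forall>w\<in>Z. L2_inner S (Ls z) (Ls w) = L2_inner S q w))"

definition orth_proj ::
    "'a::euclidean_space set \<Rightarrow> ('a \<Rightarrow> real) set \<Rightarrow> ('a \<Rightarrow> real) \<Rightarrow> 'a \<Rightarrow> real" where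
  "orth_proj S V q =
     (SOME p. p \<in> V \<and> (\<forall>v\<in>V. L2_inner S (\<lambda>x. q x - p x) v = 0))"

definition L2_image ::
    "'a::euclidean_space set \<Rightarrow> (('a \<Rightarrow> real) \<Rightarrow> 'a \<Rightarrow> real) \<Rightarrow> ('a \<Rightarrow> real) set \<Rightarrow> ('a \<Rightarrow> real) set" where
  "L2_image S A V = {g \<in> L2_space S. \<exists>v\<in>V. L2_eq S g (A v)}"

abbreviation Proj_star ::
    "'a::euclidean_space set \<Rightarrow> (('a \<Rightarrow> real) \<Rightarrow> 'a \<Rightarrow> real) \<Rightarrow> ('a \<Rightarrow> real) set \<Rightarrow> ('a \<Rightarrow> real) \<Rightarrow> 'a \<Rightarrow> real"
  where "Proj_star S Ls Z \<equiv> orth_proj S (L2_image S Ls Z)"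

section \<open>The equivalent formulations of the method\<close>

definition dual_norm_minimizer where
  "dual_norm_minimizer S L Ls U Z f uh \<longleftrightarrow>
     is_arg_min (\<lambda>v. L2_inner S (LwLs_inv S Ls Z (\<lambda>x. L v x - f x)) (\<lambda>x. L v x - f x))
       (\<lambda>v. v \<in> U) uh"

definition dual_norm_variational where
  "dual_norm_variational S L Ls U Z f uh \<longleftrightarrow>
     uh \<in> U \<and>
     (\<forall>v\<in>U. L2_inner S (LwLs_inv S Ls Z (L uh)) (L v) = L2_inner S (LwLs_inv S Ls Z f) (L v))"

definition mixed_solution where
  "mixed_solution S Ls U Z f uh \<longleftrightarrow>
     uh \<in> U \<and>
     (\<exists>z\<in>Z. (\<forall>w\<in>Z. L2_inner S (Ls z) (Ls w) + L2_inner S uh (Ls w) = L2_inner S f w) \<and>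
             (\<forall>v\<in>U. L2_inner S (Ls z) v = 0))"

definition projection_minimizer where
  "projection_minimizer S Ls U Z u uh \<longleftrightarrow>
     is_arg_min (\<lambda>v. (L2_norm S (Proj_star S Ls Z (\<lambda>x. v x - u x)))\<^sup>2) (\<lambda>v. v \<in> U) uh"

definition projection_variational where
  "projection_variational S Ls U Z u uh \<longleftrightarrow>
     uh \<in> U \<and>
     (\<forall>v\<in>U. L2_inner S (Proj_star S Ls Z uh) v = L2_inner S (Proj_star S Ls Z u) v)"

definition LLstar_inv_solution where
  "LLstar_inv_solution S L Ls U Z f u uh \<longleftrightarrow>
     dual_norm_minimizer S L Ls U Z f uh \<or>
     dual_norm_variational S L Ls U Z f uh \<or>
     mixed_solution S Ls U Z f uh \<or>
     projection_minimizer S Ls U Z u uh \<or>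
     projection_variational S Ls U Z u uh"

end

theory Submission
  imports Defs
begin

text \<open>Write \<open>\<Pi>\<close> for the orthogonal projection onto \<open>L\<^sup>*(Z)\<close>. Since \<open>\<langle>L v, w\<rangle> = \<langle>v, L\<^sup>*w\<rangle>\<close> for \<open>w \<in> Z\<close>,
  the function \<open>L\<^sup>*z\<close> with \<open>z = (L\<^sub>wL\<^sup>*)\<^sup>-\<^sup>1 (L v)\<close> is \<open>\<Pi> v\<close>; this turns every formulation of the method
  into the Galerkin orthogonality \<open>\<langle>\<Pi> u\<^sup>h - \<Pi> u, v\<rangle> = 0\<close> for \<open>v \<in> U\<close>. For \<open>v \<in> U\<close> put
  \<open>e = u\<^sup>h - v\<close>. The orthogonality gives \<open>\<parallel>\<Pi> e\<parallel>\<^sup>2 = \<langle>u - v, \<Pi> e\<rangle>\<close>, so \<open>\<parallel>\<Pi> e\<parallel> \<le> \<parallel>u - v\<parallel>\<close>, and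
  the inf-sup condition gives \<open>c\<^sub>I \<parallel>e\<parallel> \<le> \<parallel>\<Pi> e\<parallel>\<close>. The triangle inequality concludes.\<close>

section \<open>The semi-inner product on square-integrable functions\<close>

text \<open>The product is dominated by the integrable function
  \<open>(u x)\<^sup>2 + (v x)\<^sup>2\<close>.\<close>

lemma integrable_L2_mult:
  assumes "u \<in> L2_space S" "v \<in> L2_space S"
  shows "integrable (lebesgue_on S) (\<lambda>x. u x * v x)"
proof (rule Bochner_Integration.integrable_bound)
  show "integrable (lebesgue_on S) (\<lambda>x. (u x)\<^sup>2 + (v x)\<^sup>2)"
    using assms by (auto simp: L2_space_def)
  show "(\<lambda>x. u x * v x) \<in> borel_measurable (lebesgue_on S)"
    using assms by (auto simp: L2_space_def)
  have "\<bar>a * b\<bar> \<le> a\<^sup>2 + b\<^sup>2" for a b :: real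
  proof -
    have "2 * (\<bar>a\<bar> * \<bar>b\<bar>) \<le> a\<^sup>2 + b\<^sup>2"
      using sum_squares_bound[of "\<bar>a\<bar>" "\<bar>b\<bar>"] by simp
    moreover have "0 \<le> \<bar>a\<bar> * \<bar>b\<bar>" by simp
    ultimately show ?thesis unfolding abs_mult by linarith
  qed
  then show "AE x in lebesgue_on S. norm (u x * v x) \<le> norm ((u x)\<^sup>2 + (v x)\<^sup>2)"
    by (intro always_eventually) (simp add: abs_of_nonneg)
qed

lemma L2_space_zero [simp]: "(\<lambda>_. 0) \<in> L2_space S"
  by (simp add: L2_space_def)

lemma L2_space_add [simp]:
  assumes "u \<in> L2_space S" "v \<in> L2_space S"
  shows "(\<lambda>x. u x + v x) \<in> L2_space S"
proof -
  have "integrable (lebesgue_on S) (\<lambda>x. (u x)\<^sup>2 + (v x)\<^sup>2 + 2 * (u x * v x))"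
    using assms integrable_L2_mult[OF assms]
    by (intro Bochner_Integration.integrable_add integrable_mult_right) (auto simp: L2_space_def)
  then have "integrable (lebesgue_on S) (\<lambda>x. (u x + v x)\<^sup>2)"
    by (simp add: power2_sum mult.assoc)
  then show ?thesis using assms by (auto simp: L2_space_def)
qed

lemma L2_space_scale [simp]:
  assumes "u \<in> L2_space S" shows "(\<lambda>x. c * u x) \<in> L2_space S"
  using assms by (auto simp: L2_space_def power_mult_distrib)

lemma L2_space_diff [simp]:
  assumes "u \<in> L2_space S" "v \<in> L2_space S"
  shows "(\<lambda>x. u x - v x) \<in> L2_space S"
  using L2_space_add[OF assms(1) L2_space_scale[OF assms(2), of "-1"]] by simp

lemma L2_space_sum:
  assumes "\<And>b. b \<in> B \<Longrightarrow> g b \<in> L2_space S"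
  shows "(\<lambda>x. \<Sum>b\<in>B. c b * g b x) \<in> L2_space S"
  using assms by (induction B rule: infinite_finite_induct) auto

lemma L2_inner_commute: "L2_inner S u v = L2_inner S v u"
  by (simp add: L2_inner_def mult.commute)

lemma L2_inner_zero_right [simp]: "L2_inner S v (\<lambda>_. 0) = 0"
  by (simp add: L2_inner_def)

lemma L2_inner_add_left:
  assumes "u \<in> L2_space S" "v \<in> L2_space S" "w \<in> L2_space S"
  shows "L2_inner S (\<lambda>x. u x + v x) w = L2_inner S u w + L2_inner S v w"
  using assms by (simp add: L2_inner_def distrib_right integrable_L2_mult)

lemma L2_inner_diff_left:
  assumes "u \<in> L2_space S" "v \<in> L2_space S" "w \<in> L2_space S"
  shows "L2_inner S (\<lambda>x. u x - v x) w = L2_inner S u w - L2_inner S v w"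
  using assms by (simp add: L2_inner_def left_diff_distrib integrable_L2_mult)

lemma L2_inner_scale_left: "L2_inner S (\<lambda>x. c * u x) w = c * L2_inner S u w"
  by (simp add: L2_inner_def mult.assoc)

lemma L2_inner_add_right:
  assumes "u \<in> L2_space S" "v \<in> L2_space S" "w \<in> L2_space S"
  shows "L2_inner S w (\<lambda>x. u x + v x) = L2_inner S w u + L2_inner S w v"
  using L2_inner_add_left[OF assms] by (simp add: L2_inner_commute)

lemma L2_inner_diff_right:
  assumes "u \<in> L2_space S" "v \<in> L2_space S" "w \<in> L2_space S"
  shows "L2_inner S w (\<lambda>x. u x - v x) = L2_inner S w u - L2_inner S w v"
  using L2_inner_diff_left[OF assms] by (simp add: L2_inner_commute)

lemma L2_inner_scale_right: "L2_inner S w (\<lambda>x. c * u x) = c * L2_inner S w u"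
  by (simp add: L2_inner_commute[of S w] L2_inner_scale_left)

lemmas L2_inner_linear =
  L2_inner_add_left L2_inner_diff_left L2_inner_scale_left
  L2_inner_add_right L2_inner_diff_right L2_inner_scale_right

lemma L2_inner_sum_right:
  assumes "\<And>b. b \<in> B \<Longrightarrow> g b \<in> L2_space S" "w \<in> L2_space S"
  shows "L2_inner S w (\<lambda>x. \<Sum>b\<in>B. c b * g b x) = (\<Sum>b\<in>B. c b * L2_inner S w (g b))"
  using assms
  by (induction B rule: infinite_finite_induct) (auto simp: L2_inner_linear L2_space_sum)

lemma L2_inner_nonneg: "0 \<le> L2_inner S u u"
  by (simp add: L2_inner_def)

lemma L2_norm_nonneg [simp]: "0 \<le> L2_norm S u"
  by (simp add: L2_norm_def L2_inner_nonneg)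

lemma L2_norm_square: "(L2_norm S u)\<^sup>2 = L2_inner S u u"
  by (simp add: L2_norm_def L2_inner_nonneg)

lemma L2_norm_minus_commute: "L2_norm S (\<lambda>x. u x - v x) = L2_norm S (\<lambda>x. v x - u x)"
  by (simp add: L2_norm_def L2_inner_def algebra_simps)

text \<open>Serves twice: for Cauchy-Schwarz, and with \<open>a = 0\<close> as the first-order
  optimality condition of a quadratic functional. The leading coefficient may vanish because the
  inner product is only semidefinite on representatives.\<close>

lemma nonneg_quadratic_discriminant:
  fixes a b c :: real
  assumes "\<And>t. 0 \<le> a + 2 * t * b + t\<^sup>2 * c" "0 \<le> c"
  shows "b\<^sup>2 \<le> a * c"
proof (cases "c = 0")
  case True
  have "b = 0"
  proof (rule ccontr)
    assume "b \<noteq> 0"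
    \<comment> \<open>With \<open>c = 0\<close> the expression is affine in \<open>t\<close>; the
      chosen \<open>t\<close> gives it the value -1.\<close>
    then show False
      using assms(1)[of "- (a + 1) / (2 * b)"] True by (simp add: field_simps)
  qed
  then show ?thesis using True by simp
next
  case False
  then have "0 < c" using assms(2) by simp
  \<comment> \<open>The vertex \<open>t = - b / c\<close> of the parabola gives the sharpest
    instance.\<close>
  moreover have "a + 2 * (- b / c) * b + (- b / c)\<^sup>2 * c = a - b\<^sup>2 / c"
    using False by (simp add: field_simps power2_eq_square)
  then have "b\<^sup>2 / c \<le> a" using assms(1)[of "- b / c"] by linarith
  ultimately show ?thesis by (simp add: pos_divide_le_eq)
qed

lemma L2_inner_add_scale_square:
  assumes "u \<in> L2_space S" "v \<in> L2_space S"
  shows "L2_inner S (\<lambda>x. u x + t * v x) (\<lambda>x. u x + t * v x)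
    = L2_inner S u u + 2 * t * L2_inner S u v + t\<^sup>2 * L2_inner S v v"
  using assms
  by (simp add: L2_inner_linear L2_inner_commute[of S v u] algebra_simps power2_eq_square)

lemma L2_Cauchy_Schwarz:
  assumes "u \<in> L2_space S" "v \<in> L2_space S"
  shows "\<bar>L2_inner S u v\<bar> \<le> L2_norm S u * L2_norm S v"
proof -
  have "(L2_inner S u v)\<^sup>2 \<le> L2_inner S u u * L2_inner S v v"
    using L2_inner_nonneg[of S "\<lambda>x. u x + _ * v x"]
    by (intro nonneg_quadratic_discriminant) (simp_all add: L2_inner_add_scale_square assms L2_inner_nonneg)
  then have "\<bar>L2_inner S u v\<bar>\<^sup>2 \<le> (L2_norm S u * L2_norm S v)\<^sup>2"
    by (simp add: power_mult_distrib L2_norm_square)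
  then show ?thesis by (rule power2_le_imp_le) simp
qed

lemma L2_norm_triangle:
  assumes "u \<in> L2_space S" "v \<in> L2_space S"
  shows "L2_norm S (\<lambda>x. u x + v x) \<le> L2_norm S u + L2_norm S v"
proof (rule power2_le_imp_le)
  have "(L2_norm S (\<lambda>x. u x + v x))\<^sup>2 = (L2_norm S u)\<^sup>2 + 2 * L2_inner S u v + (L2_norm S v)\<^sup>2"
    using L2_inner_add_scale_square[OF assms, of 1] by (simp add: L2_norm_square)
  also have "\<dots> \<le> (L2_norm S u + L2_norm S v)\<^sup>2"
    using L2_Cauchy_Schwarz[OF assms] by (simp add: power2_sum)
  finally show "(L2_norm S (\<lambda>x. u x + v x))\<^sup>2 \<le> (L2_norm S u + L2_norm S v)\<^sup>2" .
qed simp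

section \<open>Equality almost everywhere and its compatibility with the inner product\<close>

lemma L2_eq_refl [simp]: "L2_eq S u u"
  by (simp add: L2_eq_def)

lemma L2_eq_sym: "L2_eq S u v \<Longrightarrow> L2_eq S v u"
  unfolding L2_eq_def by (erule eventually_mono) simp

lemma L2_eq_trans: "L2_eq S u v \<Longrightarrow> L2_eq S v w \<Longrightarrow> L2_eq S u w"
  unfolding L2_eq_def by (erule (1) eventually_elim2) simp

lemma L2_eq_add: "L2_eq S u v \<Longrightarrow> L2_eq S u' v' \<Longrightarrow> L2_eq S (\<lambda>x. u x + u' x) (\<lambda>x. v x + v' x)"
  unfolding L2_eq_def by (erule (1) eventually_elim2) simp

lemma L2_eq_scale: "L2_eq S u v \<Longrightarrow> L2_eq S (\<lambda>x. c * u x) (\<lambda>x. c * v x)"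
  unfolding L2_eq_def by (erule eventually_mono) simp

lemma L2_inner_cong:
  assumes "L2_eq S u v" "u \<in> L2_space S" "v \<in> L2_space S" "w \<in> L2_space S"
  shows "L2_inner S u w = L2_inner S v w"
  unfolding L2_inner_def
proof (rule integral_cong_AE)
  show "AE x in lebesgue_on S. u x * w x = v x * w x"
    using assms(1) unfolding L2_eq_def by (rule eventually_mono) simp
qed (use assms in \<open>auto simp: L2_space_def\<close>)

lemma L2_zero_iff:
  assumes "u \<in> L2_space S"
  shows "L2_zero S u \<longleftrightarrow> L2_inner S u u = 0"
  using integral_nonneg_eq_0_iff_AE[OF integrable_L2_mult[OF assms assms]]
  by (simp add: L2_zero_def L2_eq_def L2_inner_def)

lemma L2_eq_iff:
  assumes "u \<in> L2_space S" "v \<in> L2_space S"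
  shows "L2_eq S u v \<longleftrightarrow> L2_inner S (\<lambda>x. u x - v x) (\<lambda>x. u x - v x) = 0"
  using L2_zero_iff[OF L2_space_diff[OF assms]] by (simp add: L2_zero_def L2_eq_def)

text \<open>If \<open>g\<close> were not null, some \<open>u\<close> in \<open>D\<close> would lie
  closer to \<open>g\<close> than \<open>L2_norm S g\<close>. Orthogonality turns the square of that
  norm into the pairing of \<open>u - g\<close> with \<open>g\<close>, up to sign, and
  Cauchy-Schwarz makes it smaller than itself.\<close>

lemma L2_dense_orthogonal:
  assumes "densely_defined S D" "D \<subseteq> L2_space S" "g \<in> L2_space S"
    and orth: "\<And>u. u \<in> D \<Longrightarrow> L2_inner S u g = 0"
  shows "L2_zero S g"
proof (rule ccontr)
  assume "\<not> L2_zero S g"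
  then have "0 < (L2_norm S g)\<^sup>2"
    using L2_inner_nonneg[of S g] by (simp add: L2_zero_iff assms L2_norm_square)
  then have "0 < L2_norm S g"
    using L2_norm_nonneg[of S g] by (simp add: less_le)
  then obtain u where u: "u \<in> D" "L2_norm S (\<lambda>x. u x - g x) < L2_norm S g"
    using assms unfolding densely_defined_def by blast
  have "(L2_norm S g)\<^sup>2 = \<bar>L2_inner S (\<lambda>x. u x - g x) g\<bar>"
    using u(1) assms orth L2_inner_nonneg[of S g] by (auto simp: L2_norm_square L2_inner_linear)
  also have "\<dots> \<le> L2_norm S (\<lambda>x. u x - g x) * L2_norm S g"
    using u(1) assms by (intro L2_Cauchy_Schwarz) auto
  also have "\<dots> < L2_norm S g * L2_norm S g"
    using u(2) \<open>0 < L2_norm S g\<close> by simp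
  finally show False by (simp add: power2_eq_square)
qed

section \<open>Orthogonal projections onto finite-dimensional subspaces\<close>

lemma fun_subspace_add: "fun_subspace V \<Longrightarrow> u \<in> V \<Longrightarrow> v \<in> V \<Longrightarrow> (\<lambda>x. u x + v x) \<in> V"
  by (simp add: fun_subspace_def)

lemma fun_subspace_scale: "fun_subspace V \<Longrightarrow> u \<in> V \<Longrightarrow> (\<lambda>x. c * u x) \<in> V"
  by (simp add: fun_subspace_def)

lemma fun_subspace_diff: "fun_subspace V \<Longrightarrow> u \<in> V \<Longrightarrow> v \<in> V \<Longrightarrow> (\<lambda>x. u x - v x) \<in> V"
  using fun_subspace_add[OF _ _ fun_subspace_scale[of V v "-1"], of u] by simp

text \<open>Quantifying over all subspaces containing \<open>B\<close> says that \<open>p\<close> lies in the span of \<open>B\<close>.\<close>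

lemma projection_onto_finite_span:
  assumes "finite B" "B \<subseteq> L2_space S" "q \<in> L2_space S"
  shows "\<exists>p. (\<forall>V. fun_subspace V \<longrightarrow> B \<subseteq> V \<longrightarrow> p \<in> V) \<and>
           (\<forall>b\<in>B. L2_inner S (\<lambda>x. q x - p x) b = 0)"
  using assms
proof (induction B arbitrary: q rule: finite_induct)
  case empty
  then show ?case by (intro exI[of _ "\<lambda>_. 0"]) (simp add: fun_subspace_def)
next
  case (insert b B)
  have b: "b \<in> L2_space S" and B: "B \<subseteq> L2_space S" using insert.prems by auto
  have L2: "fun_subspace (L2_space S)" by (simp add: fun_subspace_def)
  \<comment> \<open>One Gram-Schmidt step: the induction hypothesis is applied to the new vector
    \<open>b\<close> as well as to \<open>q\<close>, so that \<open>b - r\<close> is orthogonal to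
    \<open>B\<close>.\<close>
  obtain r where r: "\<And>V. fun_subspace V \<Longrightarrow> B \<subseteq> V \<Longrightarrow> r \<in> V"
    and r_orth: "\<And>b'. b' \<in> B \<Longrightarrow> L2_inner S (\<lambda>x. b x - r x) b' = 0"
    using insert.IH[OF B b] by blast
  obtain p where p: "\<And>V. fun_subspace V \<Longrightarrow> B \<subseteq> V \<Longrightarrow> p \<in> V"
    and p_orth: "\<And>b'. b' \<in> B \<Longrightarrow> L2_inner S (\<lambda>x. q x - p x) b' = 0"
    using insert.IH[OF B insert.prems(2)] by blast
  have rL: "r \<in> L2_space S" and pL: "p \<in> L2_space S" using r p L2 B by auto
  note mem [simp] = b rL pL \<open>q \<in> L2_space S\<close>
  define s where "s = (\<lambda>x. b x - r x)"
  have sL [simp]: "s \<in> L2_space S" by (simp add: s_def)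
  \<comment> \<open>The Fourier coefficient of \<open>q - p\<close> along \<open>s\<close>. If
    \<open>s\<close> is null, the division yields 0, and Cauchy-Schwarz then gives the orthogonality
    to \<open>s\<close>.\<close>
  define t where "t = L2_inner S (\<lambda>x. q x - p x) s / L2_inner S s s"
  define p' where "p' = (\<lambda>x. p x + t * s x)"
  have p'L [simp]: "p' \<in> L2_space S" by (simp add: p'_def)
  have residual: "L2_inner S (\<lambda>x. q x - p' x) w
      = L2_inner S (\<lambda>x. q x - p x) w - t * L2_inner S s w" if "w \<in> L2_space S" for w
    using that by (simp add: p'_def L2_inner_linear)
  have orth_B: "L2_inner S (\<lambda>x. q x - p' x) b' = 0" if "b' \<in> B" for b'
    using that B p_orth[OF that] r_orth[OF that] by (auto simp: residual s_def[symmetric])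
  have "L2_inner S (\<lambda>x. q x - p' x) s = 0"
  proof (cases "L2_inner S s s = 0")
    case True
    have "\<bar>L2_inner S (\<lambda>x. q x - p x) s\<bar> \<le> L2_norm S (\<lambda>x. q x - p x) * L2_norm S s"
      by (rule L2_Cauchy_Schwarz) simp_all
    then show ?thesis using True by (simp add: residual L2_norm_def)
  next
    case False
    then show ?thesis by (simp add: residual t_def)
  qed
  moreover have "L2_inner S (\<lambda>x. q x - p' x) r = 0"
  proof -
    \<comment> \<open>The vectors orthogonal to the residual form a subspace containing
      \<open>B\<close>; since \<open>r\<close> lies in every such subspace, it is orthogonal
      too.\<close>
    have "fun_subspace {v \<in> L2_space S. L2_inner S (\<lambda>x. q x - p' x) v = 0}"
      by (simp add: fun_subspace_def L2_inner_add_right L2_inner_scale_right)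
    then show ?thesis using r B orth_B by blast
  qed
  moreover have "b = (\<lambda>x. s x + r x)" by (simp add: s_def)
  ultimately have "L2_inner S (\<lambda>x. q x - p' x) b = 0"
    by (simp add: L2_inner_add_right)
  moreover have "p' \<in> V" if V: "fun_subspace V" "insert b B \<subseteq> V" for V
  proof -
    have "s \<in> V" using V r[of V] unfolding s_def by (intro fun_subspace_diff) auto
    then show ?thesis
      using V p[of V] unfolding p'_def by (intro fun_subspace_add fun_subspace_scale) auto
  qed
  ultimately show ?case using orth_B by blast
qed

text \<open>A relation, since a projection is determined only up to equality almost everywhere: it
  admits every representative in \<open>V\<close>, while \<open>orth_proj\<close> picks one.\<close>

definition is_orth_proj ::
    "'a::euclidean_space set \<Rightarrow> ('a \<Rightarrow> real) set \<Rightarrow> ('a \<Rightarrow> real) \<Rightarrow> ('a \<Rightarrow> real) \<Rightarrow> bool" where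
  "is_orth_proj S V q p \<longleftrightarrow> p \<in> V \<and> (\<forall>v\<in>V. L2_inner S q v = L2_inner S p v)"

text \<open>The difference \<open>p - p'\<close> lies in \<open>V\<close>, so it may be used as a
  test function, and its norm comes out as 0.\<close>

lemma is_orth_proj_unique:
  assumes "fun_subspace V" "V \<subseteq> L2_space S" "is_orth_proj S V q p" "is_orth_proj S V q p'"
  shows "L2_eq S p p'"
proof -
  have p: "p \<in> V" "p' \<in> V" and L: "p \<in> L2_space S" "p' \<in> L2_space S"
    using assms by (auto simp: is_orth_proj_def)
  have d: "(\<lambda>x. p x - p' x) \<in> V" by (intro fun_subspace_diff assms p)
  then have "L2_inner S p (\<lambda>x. p x - p' x) = L2_inner S p' (\<lambda>x. p x - p' x)"
    using assms(3,4) by (auto simp: is_orth_proj_def)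
  then show ?thesis
    using L by (simp add: L2_eq_iff L2_inner_diff_left)
qed

lemma is_orth_proj_add_scale:
  assumes "fun_subspace V" "V \<subseteq> L2_space S" "is_orth_proj S V q p" "is_orth_proj S V q' p'"
    and "q \<in> L2_space S" "q' \<in> L2_space S"
  shows "is_orth_proj S V (\<lambda>x. q x + c * q' x) (\<lambda>x. p x + c * p' x)"
proof -
  have p: "p \<in> V" "p' \<in> V" using assms by (auto simp: is_orth_proj_def)
  then have L: "p \<in> L2_space S" "p' \<in> L2_space S" using assms by auto
  have "(\<lambda>x. p x + c * p' x) \<in> V"
    by (intro fun_subspace_add fun_subspace_scale assms(1) p)
  moreover have "L2_inner S (\<lambda>x. q x + c * q' x) v = L2_inner S (\<lambda>x. p x + c * p' x) v"
    if "v \<in> V" for v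
    using assms that L subsetD[OF assms(2) that] by (auto simp: is_orth_proj_def L2_inner_linear)
  ultimately show ?thesis by (simp add: is_orth_proj_def)
qed

lemma is_orth_proj_diff:
  assumes "fun_subspace V" "V \<subseteq> L2_space S" "is_orth_proj S V q p" "is_orth_proj S V q' p'"
    and "q \<in> L2_space S" "q' \<in> L2_space S"
  shows "is_orth_proj S V (\<lambda>x. q x - q' x) (\<lambda>x. p x - p' x)"
  using is_orth_proj_add_scale[OF assms, of "-1"] by simp

section \<open>The adjoint operator\<close>

locale L2_operator =
  fixes S :: "'a::euclidean_space set" and D :: "('a \<Rightarrow> real) set"
    and L :: "('a \<Rightarrow> real) \<Rightarrow> 'a \<Rightarrow> real"
  assumes linear_op: "linear_operator S D L" and dense: "densely_defined S D"
begin

abbreviation "Ls \<equiv> adj S D L"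

lemma dom_L2: "v \<in> D \<Longrightarrow> v \<in> L2_space S"
  using linear_op by (auto simp: linear_operator_def)

lemma op_L2: "v \<in> D \<Longrightarrow> L v \<in> L2_space S"
  using linear_op by (auto simp: linear_operator_def)

lemma adj_props:
  assumes "w \<in> adj_dom S D L"
  shows adj_L2: "Ls w \<in> L2_space S"
    and adj_inner: "v \<in> D \<Longrightarrow> L2_inner S (L v) w = L2_inner S v (Ls w)"
proof -
  have "\<exists>g. g \<in> L2_space S \<and> (\<forall>u\<in>D. L2_inner S (L u) w = L2_inner S u g)"
    using assms by (auto simp: adj_dom_def)
  from someI_ex[OF this] show "Ls w \<in> L2_space S"
    and "v \<in> D \<Longrightarrow> L2_inner S (L v) w = L2_inner S v (Ls w)"
    by (auto simp: adj_def)
qed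

text \<open>Two candidates for the adjoint differ by a function orthogonal to the dense domain.
  Identities for \<open>Ls\<close> reduce in this way to identities tested against
  \<open>D\<close>.\<close>

lemma adj_unique:
  assumes "w \<in> adj_dom S D L" "g \<in> L2_space S"
    and "\<And>v. v \<in> D \<Longrightarrow> L2_inner S (L v) w = L2_inner S v g"
  shows "L2_eq S (Ls w) g"
proof -
  have "L2_zero S (\<lambda>x. Ls w x - g x)"
    using assms adj_props[OF assms(1)] dom_L2
    by (intro L2_dense_orthogonal[OF dense]) (auto simp: L2_inner_linear)
  then show ?thesis by (simp add: L2_zero_def L2_eq_def)
qed

end

section \<open>The discrete spaces and the image of \<open>Z\<close> under the adjoint\<close>

locale LLstar_discretization = L2_operator +
  fixes U Z :: "('a \<Rightarrow> real) set"
  assumes U: "discrete_space S D U" and Z: "discrete_space S (adj_dom S D L) Z"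
begin

text \<open>The representatives \<open>Ls w\<close> are arbitrary choices, so \<open>Ls\<close> is
  linear only almost everywhere. Closing the image under equality almost everywhere makes it a
  subspace of functions.\<close>

abbreviation "V \<equiv> L2_image S Ls Z"

lemma U_dom: "v \<in> U \<Longrightarrow> v \<in> D"
  using U by (auto simp: discrete_space_def)

lemma U_L2: "v \<in> U \<Longrightarrow> v \<in> L2_space S"
  by (simp add: U_dom dom_L2)

lemma U_subspace: "fun_subspace U"
  using U by (simp add: discrete_space_def)

lemma Z_dom: "w \<in> Z \<Longrightarrow> w \<in> adj_dom S D L"
  using Z by (auto simp: discrete_space_def)

lemma Z_L2: "w \<in> Z \<Longrightarrow> w \<in> L2_space S"
  using Z_dom by (auto simp: adj_dom_def)

lemma Ls_L2: "w \<in> Z \<Longrightarrow> Ls w \<in> L2_space S"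
  by (simp add: Z_dom adj_L2)

lemma Ls_inner: "w \<in> Z \<Longrightarrow> v \<in> D \<Longrightarrow> L2_inner S (L v) w = L2_inner S v (Ls w)"
  by (simp add: Z_dom adj_inner)

lemma V_L2: "V \<subseteq> L2_space S"
  by (auto simp: L2_image_def)

lemma Ls_in_V: "w \<in> Z \<Longrightarrow> Ls w \<in> V"
  by (auto simp: L2_image_def Ls_L2 intro: bexI[of _ w])

lemma Ls_add:
  assumes "w \<in> Z" "w' \<in> Z"
  shows "(\<lambda>x. w x + w' x) \<in> Z" "L2_eq S (Ls (\<lambda>x. w x + w' x)) (\<lambda>x. Ls w x + Ls w' x)"
proof -
  show sum: "(\<lambda>x. w x + w' x) \<in> Z"
    using Z assms by (auto simp: discrete_space_def fun_subspace_def)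
  show "L2_eq S (Ls (\<lambda>x. w x + w' x)) (\<lambda>x. Ls w x + Ls w' x)"
    by (rule adj_unique)
      (use sum assms in \<open>simp_all add: Z_dom Ls_L2 L2_inner_linear Z_L2 op_L2 dom_L2 Ls_inner\<close>)
qed

lemma Ls_scale:
  assumes "w \<in> Z"
  shows "(\<lambda>x. c * w x) \<in> Z" "L2_eq S (Ls (\<lambda>x. c * w x)) (\<lambda>x. c * Ls w x)"
proof -
  show cw: "(\<lambda>x. c * w x) \<in> Z"
    using Z assms by (auto simp: discrete_space_def fun_subspace_def)
  show "L2_eq S (Ls (\<lambda>x. c * w x)) (\<lambda>x. c * Ls w x)"
    by (rule adj_unique)
      (use cw assms in \<open>simp_all add: Z_dom Ls_L2 L2_inner_linear Z_L2 op_L2 dom_L2 Ls_inner\<close>)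
qed

lemma V_subspace: "fun_subspace V"
proof -
  have add: "(\<lambda>x. g x + g' x) \<in> V" if g: "g \<in> V" "g' \<in> V" for g g'
  proof -
    obtain w w' where w: "w \<in> Z" "L2_eq S g (Ls w)" "w' \<in> Z" "L2_eq S g' (Ls w')"
      using g by (auto simp: L2_image_def)
    have "L2_eq S (\<lambda>x. g x + g' x) (Ls (\<lambda>x. w x + w' x))"
      using L2_eq_trans[OF L2_eq_add[OF w(2,4)] L2_eq_sym[OF Ls_add(2)[OF w(1,3)]]] .
    then show ?thesis
      using that Ls_add(1)[OF w(1,3)] by (auto simp: L2_image_def)
  qed
  have scale: "(\<lambda>x. c * g x) \<in> V" if g: "g \<in> V" for c g
  proof -
    obtain w where w: "w \<in> Z" "L2_eq S g (Ls w)"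
      using g by (auto simp: L2_image_def)
    have "L2_eq S (\<lambda>x. c * g x) (Ls (\<lambda>x. c * w x))"
      using L2_eq_trans[OF L2_eq_scale[OF w(2)] L2_eq_sym[OF Ls_scale(2)[OF w(1)]]] .
    then show ?thesis
      using that Ls_scale(1)[OF w(1)] by (auto simp: L2_image_def)
  qed
  obtain w where "w \<in> Z" using Z by (auto simp: discrete_space_def)
  then have "(\<lambda>_. 0) \<in> V" using scale[OF Ls_in_V, of w 0] by simp
  then show ?thesis using add scale by (auto simp: fun_subspace_def)
qed

text \<open>Every element of \<open>V\<close> agrees almost everywhere with some
  \<open>Ls w\<close>, so testing against these functions is enough.\<close>

lemma is_orth_proj_Ls:
  assumes "q \<in> L2_space S" "z \<in> Z" "\<And>w. w \<in> Z \<Longrightarrow> L2_inner S q (Ls w) = L2_inner S (Ls z) (Ls w)"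
  shows "is_orth_proj S V q (Ls z)"
proof -
  have "L2_inner S q g = L2_inner S (Ls z) g" if g: "g \<in> V" for g
  proof -
    obtain w where w: "w \<in> Z" "L2_eq S g (Ls w)" "g \<in> L2_space S"
      using g by (auto simp: L2_image_def)
    then show ?thesis
      using assms L2_inner_cong[OF w(2,3) Ls_L2]
      by (metis L2_inner_commute Ls_L2)
  qed
  then show ?thesis using assms by (simp add: is_orth_proj_def Ls_in_V)
qed

section \<open>The projection onto the image of the adjoint\<close>

text \<open>A finite spanning set \<open>B\<close> of \<open>Z\<close> yields the finite spanning
  set of all \<open>Ls b\<close> for \<open>V\<close>, up to null functions; the projection onto its
  span is the one sought.\<close>

lemma ex_is_orth_proj:
  assumes q: "q \<in> L2_space S"
  shows "\<exists>p. is_orth_proj S V q p"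
proof -
  obtain B where B: "finite B" "B \<subseteq> Z"
    and span: "\<And>w. w \<in> Z \<Longrightarrow> \<exists>c. L2_eq S w (\<lambda>x. \<Sum>b\<in>B. c b * b x)"
    using Z by (auto simp: discrete_space_def)
  have BL: "\<And>b. b \<in> B \<Longrightarrow> b \<in> L2_space S" "\<And>b. b \<in> B \<Longrightarrow> Ls b \<in> L2_space S"
    using B Z_L2 Ls_L2 by auto
  have "finite (Ls ` B)" "Ls ` B \<subseteq> L2_space S"
    using B Ls_L2 by auto
  from projection_onto_finite_span[OF this q]
  obtain p where p: "\<And>V. fun_subspace V \<Longrightarrow> Ls ` B \<subseteq> V \<Longrightarrow> p \<in> V"
    and orth: "\<And>b. b \<in> B \<Longrightarrow> L2_inner S (\<lambda>x. q x - p x) (Ls b) = 0"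
    by auto
  have pV: "p \<in> V" by (rule p[OF V_subspace]) (use B Ls_in_V in auto)
  then have res: "(\<lambda>x. q x - p x) \<in> L2_space S" using q V_L2 by auto
  have "L2_inner S q g = L2_inner S p g" if "g \<in> V" for g
  proof -
    obtain w where w: "w \<in> Z" "L2_eq S g (Ls w)" "g \<in> L2_space S"
      using \<open>g \<in> V\<close> by (auto simp: L2_image_def)
    obtain c where c: "L2_eq S w (\<lambda>x. \<Sum>b\<in>B. c b * b x)" using span[OF w(1)] by blast
    \<comment> \<open>The expansion of \<open>w\<close> holds only almost everywhere, so it is
      carried over to \<open>Ls w\<close> by testing against \<open>D\<close>.\<close>
    have "L2_eq S (Ls w) (\<lambda>x. \<Sum>b\<in>B. c b * Ls b x)"
    proof (rule adj_unique[OF Z_dom[OF w(1)] L2_space_sum[OF BL(2)]])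
      fix v assume v: "v \<in> D"
      have "L2_inner S (L v) w = L2_inner S (L v) (\<lambda>x. \<Sum>b\<in>B. c b * b x)"
        using L2_inner_cong[OF c Z_L2[OF w(1)] L2_space_sum[OF BL(1)] op_L2[OF v]]
        by (simp add: L2_inner_commute)
      also have "\<dots> = (\<Sum>b\<in>B. c b * L2_inner S v (Ls b))"
        using B v by (subst L2_inner_sum_right) (auto simp: BL op_L2 Ls_inner intro!: sum.cong)
      also have "\<dots> = L2_inner S v (\<lambda>x. \<Sum>b\<in>B. c b * Ls b x)"
        using v by (subst L2_inner_sum_right) (auto simp: BL dom_L2)
      finally show "L2_inner S (L v) w = L2_inner S v (\<lambda>x. \<Sum>b\<in>B. c b * Ls b x)" .
    qed
    then have "L2_eq S g (\<lambda>x. \<Sum>b\<in>B. c b * Ls b x)" using w(2) L2_eq_trans by blast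
    from L2_inner_cong[OF this w(3) L2_space_sum[OF BL(2)] res]
    have "L2_inner S (\<lambda>x. q x - p x) g = L2_inner S (\<lambda>x. q x - p x) (\<lambda>x. \<Sum>b\<in>B. c b * Ls b x)"
      by (simp add: L2_inner_commute)
    also have "\<dots> = 0"
      using BL res orth by (subst L2_inner_sum_right) auto
    finally show ?thesis
      using pV V_L2 q w(3) by (auto simp: L2_inner_diff_left)
  qed
  then show ?thesis using pV by (auto simp: is_orth_proj_def)
qed

abbreviation "Pr \<equiv> Proj_star S Ls Z"

lemma Pr_is_orth_proj:
  assumes q: "q \<in> L2_space S"
  shows "is_orth_proj S V q (Pr q)"
proof -
  have eq: "is_orth_proj S V q p \<longleftrightarrow> p \<in> V \<and> (\<forall>v\<in>V. L2_inner S (\<lambda>x. q x - p x) v = 0)" for p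
    using q V_L2 unfolding is_orth_proj_def by (auto simp: L2_inner_diff_left subset_iff)
  show ?thesis
    using someI_ex[OF ex_is_orth_proj[OF q, unfolded eq]] unfolding eq orth_proj_def .
qed

lemma Pr_in_V: "q \<in> L2_space S \<Longrightarrow> Pr q \<in> V"
  using Pr_is_orth_proj by (simp add: is_orth_proj_def)

lemma Pr_L2: "q \<in> L2_space S \<Longrightarrow> Pr q \<in> L2_space S"
  using Pr_in_V V_L2 by auto

lemma Pr_inner: "q \<in> L2_space S \<Longrightarrow> g \<in> V \<Longrightarrow> L2_inner S (Pr q) g = L2_inner S q g"
  using Pr_is_orth_proj by (simp add: is_orth_proj_def)

text \<open>Allows any function with the projection property to stand in for the chosen
  \<open>Pr q\<close> inside an inner product.\<close>

lemma Pr_unique: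
  assumes "is_orth_proj S V q p" "q \<in> L2_space S" "w \<in> L2_space S"
  shows "L2_inner S p w = L2_inner S (Pr q) w"
proof (rule L2_inner_cong)
  show "L2_eq S p (Pr q)"
    using is_orth_proj_unique[OF V_subspace V_L2 assms(1) Pr_is_orth_proj[OF assms(2)]] .
  show "p \<in> L2_space S" using assms(1) V_L2 by (auto simp: is_orth_proj_def)
qed (use assms Pr_L2 in auto)

lemma Pr_norm_unique:
  assumes "is_orth_proj S V q p" "q \<in> L2_space S"
  shows "L2_inner S p p = (L2_norm S (Pr q))\<^sup>2"
proof -
  have p: "p \<in> L2_space S" using assms(1) V_L2 by (auto simp: is_orth_proj_def)
  have "L2_inner S p p = L2_inner S (Pr q) p" by (rule Pr_unique[OF assms p])
  also have "\<dots> = L2_inner S p (Pr q)" by (rule L2_inner_commute)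
  also have "\<dots> = L2_inner S (Pr q) (Pr q)" by (rule Pr_unique[OF assms Pr_L2[OF assms(2)]])
  finally show ?thesis by (simp add: L2_norm_square)
qed

lemma Pr_inner_diff:
  assumes "q \<in> L2_space S" "q' \<in> L2_space S" "w \<in> L2_space S"
  shows "L2_inner S (Pr (\<lambda>x. q x - q' x)) w = L2_inner S (Pr q) w - L2_inner S (Pr q') w"
proof -
  have "is_orth_proj S V (\<lambda>x. q x - q' x) (\<lambda>x. Pr q x - Pr q' x)"
    using assms by (intro is_orth_proj_diff V_subspace V_L2 Pr_is_orth_proj)
  from Pr_unique[OF this _ assms(3)] show ?thesis
    using assms Pr_L2 by (simp add: L2_inner_diff_left)
qed

section \<open>Reduction of all formulations to the projected variational problem\<close>

text \<open>When \<open>q = L g\<close> weakly against \<open>Z\<close>, any \<open>z \<in> Z\<close> with \<open>L\<^sup>*z = \<Pi> g\<close> serves as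
  \<open>(L\<^sub>wL\<^sup>*)\<^sup>-\<^sup>1 q\<close>, so the choice in its definition is not vacuous.\<close>

lemma LwLs_inv_props:
  assumes g: "g \<in> L2_space S" and q: "\<And>w. w \<in> Z \<Longrightarrow> L2_inner S q w = L2_inner S g (Ls w)"
  shows LwLs_inv_in: "LwLs_inv S Ls Z q \<in> Z"
    and LwLs_inv_orth_proj: "is_orth_proj S V g (Ls (LwLs_inv S Ls Z q))"
proof -
  obtain z where z: "z \<in> Z" "L2_eq S (Pr g) (Ls z)"
    using Pr_in_V[OF g] by (auto simp: L2_image_def)
  have "L2_inner S (Ls z) (Ls w) = L2_inner S q w" if "w \<in> Z" for w
    using L2_inner_cong[OF z(2) Pr_L2[OF g] Ls_L2[OF z(1)] Ls_L2[OF that]]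
      Pr_inner[OF g Ls_in_V[OF that]] q[OF that] by simp
  then have "\<exists>z. z \<in> Z \<and> (\<forall>w\<in>Z. L2_inner S (Ls z) (Ls w) = L2_inner S q w)"
    using z(1) by blast
  from someI_ex[OF this]
  show "LwLs_inv S Ls Z q \<in> Z" "is_orth_proj S V g (Ls (LwLs_inv S Ls Z q))"
    using g q by (auto simp: LwLs_inv_def intro!: is_orth_proj_Ls)
qed

text \<open>The bridge between the dual-norm and projected formulations: \<open>L\<close> moves
  across the pairing as \<open>Ls\<close>, and \<open>Ls\<close> applied to the discrete inverse is
  a projection of \<open>g\<close>.\<close>

lemma LwLs_inv_inner:
  assumes "g \<in> L2_space S" "\<And>w. w \<in> Z \<Longrightarrow> L2_inner S q w = L2_inner S g (Ls w)" "v \<in> D"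
  shows "L2_inner S (LwLs_inv S Ls Z q) (L v) = L2_inner S (Pr g) v"
proof -
  have "L2_inner S (LwLs_inv S Ls Z q) (L v) = L2_inner S (Ls (LwLs_inv S Ls Z q)) v"
    using Ls_inner[OF LwLs_inv_in[OF assms(1,2)] assms(3)] by (simp add: L2_inner_commute)
  also have "\<dots> = L2_inner S (Pr g) v"
    by (rule Pr_unique[OF LwLs_inv_orth_proj[OF assms(1,2)] assms(1) dom_L2[OF assms(3)]])
  finally show ?thesis .
qed

context
  fixes f u :: "'a \<Rightarrow> real"
  assumes f: "f \<in> L2_space S" and u: "u \<in> D" and Lu: "L2_eq S (L u) f"
begin

lemma data_inner: "w \<in> Z \<Longrightarrow> L2_inner S f w = L2_inner S u (Ls w)"
  using L2_inner_cong[OF Lu op_L2[OF u] f Z_L2] Ls_inner u by simp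

lemma dual_norm_variational_imp:
  assumes "dual_norm_variational S L Ls U Z f uh"
  shows "projection_variational S Ls U Z u uh"
proof -
  have uh: "uh \<in> U" and eq: "\<And>v. v \<in> U \<Longrightarrow>
      L2_inner S (LwLs_inv S Ls Z (L uh)) (L v) = L2_inner S (LwLs_inv S Ls Z f) (L v)"
    using assms by (auto simp: dual_norm_variational_def)
  have "L2_inner S (Pr uh) v = L2_inner S (Pr u) v" if "v \<in> U" for v
    using eq[OF that] LwLs_inv_inner[of uh "L uh" v] LwLs_inv_inner[of u f v] that uh
    by (simp add: U_L2 U_dom Ls_inner data_inner u dom_L2)
  then show ?thesis using uh by (simp add: projection_variational_def)
qed

text \<open>The first equation says that \<open>Ls z\<close> is the projection of
  \<open>u - uh\<close>, the second that this projection is orthogonal to \<open>U\<close>.\<close>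

lemma mixed_solution_imp:
  assumes "mixed_solution S Ls U Z f uh"
  shows "projection_variational S Ls U Z u uh"
proof -
  obtain z where uh: "uh \<in> U" and z: "z \<in> Z"
    and eq: "\<And>w. w \<in> Z \<Longrightarrow> L2_inner S (Ls z) (Ls w) + L2_inner S uh (Ls w) = L2_inner S f w"
    and orth: "\<And>v. v \<in> U \<Longrightarrow> L2_inner S (Ls z) v = 0"
    using assms by (auto simp: mixed_solution_def)
  have L2: "u \<in> L2_space S" "uh \<in> L2_space S" using u uh by (simp_all add: dom_L2 U_L2)
  have proj: "is_orth_proj S V (\<lambda>x. u x - uh x) (Ls z)"
  proof (rule is_orth_proj_Ls)
    show "L2_inner S (\<lambda>x. u x - uh x) (Ls w) = L2_inner S (Ls z) (Ls w)" if "w \<in> Z" for w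
      using eq[OF that] L2 that by (simp add: L2_inner_diff_left Ls_L2 data_inner)
  qed (use L2 z in auto)
  have "L2_inner S (Pr uh) v = L2_inner S (Pr u) v" if "v \<in> U" for v
    using Pr_unique[OF proj _ U_L2[OF that]] orth[OF that] Pr_inner_diff[OF L2 U_L2[OF that]] L2
    by simp
  then show ?thesis using uh by (simp add: projection_variational_def)
qed

text \<open>Minimality is tested along the line \<open>uh + t * v\<close>, where the functional is
  quadratic in \<open>t\<close>.\<close>

lemma projection_minimizer_imp:
  assumes "projection_minimizer S Ls U Z u uh"
  shows "projection_variational S Ls U Z u uh"
proof -
  have uh: "uh \<in> U" and min: "\<And>v. v \<in> U \<Longrightarrow>
      (L2_norm S (Pr (\<lambda>x. uh x - u x)))\<^sup>2 \<le> (L2_norm S (Pr (\<lambda>x. v x - u x)))\<^sup>2"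
    using assms by (auto simp: projection_minimizer_def is_arg_min_def not_less)
  have L2: "u \<in> L2_space S" "uh \<in> L2_space S" using u uh by (simp_all add: dom_L2 U_L2)
  let ?p = "Pr (\<lambda>x. uh x - u x)"
  have p: "?p \<in> L2_space S" "?p \<in> V" using L2 by (simp_all add: Pr_L2 Pr_in_V)
  have "L2_inner S (Pr uh) v = L2_inner S (Pr u) v" if v: "v \<in> U" for v
  proof -
    note vL = U_L2[OF v]
    \<comment> \<open>The increase over the value at \<open>t = 0\<close>; its constant term is 0,
      so the discriminant bound forces the linear coefficient to vanish.\<close>
    have "0 \<le> 0 + 2 * t * L2_inner S ?p (Pr v) + t\<^sup>2 * L2_inner S (Pr v) (Pr v)" for t
    proof -
      have "is_orth_proj S V (\<lambda>x. (uh x - u x) + t * v x) (\<lambda>x. ?p x + t * Pr v x)"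
        using L2 vL
        by (intro is_orth_proj_add_scale[OF V_subspace V_L2] Pr_is_orth_proj) simp_all
      then have "L2_inner S (\<lambda>x. ?p x + t * Pr v x) (\<lambda>x. ?p x + t * Pr v x)
          = (L2_norm S (Pr (\<lambda>x. (uh x - u x) + t * v x)))\<^sup>2"
        using L2 vL by (intro Pr_norm_unique) simp_all
      also have "\<dots> = (L2_norm S (Pr (\<lambda>x. (uh x + t * v x) - u x)))\<^sup>2"
        by (simp add: algebra_simps)
      also have "\<dots> \<ge> L2_inner S ?p ?p"
        using min[of "\<lambda>x. uh x + t * v x"] U_subspace uh v
        by (simp add: fun_subspace_def L2_norm_square)
      finally show ?thesis
        using p vL by (simp add: L2_inner_add_scale_square Pr_L2)
    qed
    then have "(L2_inner S ?p (Pr v))\<^sup>2 \<le> 0 * L2_inner S (Pr v) (Pr v)"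
      by (rule nonneg_quadratic_discriminant) (rule L2_inner_nonneg)
    then have "L2_inner S (Pr v) ?p = 0" by (simp add: L2_inner_commute)
    then have "L2_inner S ?p v = 0"
      using Pr_inner[OF vL p(2)] by (simp add: L2_inner_commute)
    then show ?thesis using Pr_inner_diff[OF L2(2,1) vL] by simp
  qed
  then show ?thesis using uh by (simp add: projection_variational_def)
qed

text \<open>Against \<open>Z\<close> the residual \<open>L v - f\<close> acts as \<open>L\<close>
  applied to \<open>v - u\<close>, so the two functionals take the same value at every
  \<open>v\<close> in \<open>U\<close>.\<close>

lemma dual_norm_minimizer_imp:
  assumes "dual_norm_minimizer S L Ls U Z f uh"
  shows "projection_minimizer S Ls U Z u uh"
proof -
  have "L2_inner S (LwLs_inv S Ls Z (\<lambda>x. L v x - f x)) (\<lambda>x. L v x - f x)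
      = (L2_norm S (Pr (\<lambda>x. v x - u x)))\<^sup>2" if v: "v \<in> U" for v
  proof -
    let ?q = "\<lambda>x. L v x - f x" and ?g = "\<lambda>x. v x - u x"
    have g: "?g \<in> L2_space S" using v u by (simp add: U_L2 dom_L2)
    have q: "L2_inner S ?q w = L2_inner S ?g (Ls w)" if "w \<in> Z" for w
      using that v u f
      by (simp add: L2_inner_diff_left Z_L2 Ls_L2 op_L2 U_dom dom_L2 Ls_inner data_inner)
    let ?z = "LwLs_inv S Ls Z ?q"
    have z: "?z \<in> Z" "is_orth_proj S V ?g (Ls ?z)"
      by (rule LwLs_inv_in[OF g q] LwLs_inv_orth_proj[OF g q]; assumption)+
    have "L2_inner S ?z ?q = L2_inner S ?g (Ls ?z)" using q[OF z(1)] by (simp add: L2_inner_commute)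
    also have "\<dots> = L2_inner S (Ls ?z) (Ls ?z)"
      using z Ls_in_V by (simp add: is_orth_proj_def)
    also have "\<dots> = (L2_norm S (Pr ?g))\<^sup>2" by (rule Pr_norm_unique[OF z(2) g])
    finally show ?thesis .
  qed
  then show ?thesis
    using assms by (auto simp: dual_norm_minimizer_def projection_minimizer_def is_arg_min_def)
qed

lemma LLstar_inv_solution_imp:
  assumes "LLstar_inv_solution S L Ls U Z f u uh"
  shows "projection_variational S Ls U Z u uh"
  using assms dual_norm_minimizer_imp dual_norm_variational_imp mixed_solution_imp
    projection_minimizer_imp
  by (auto simp: LLstar_inv_solution_def)

end

section \<open>The inf-sup condition and quasi-optimality\<close>

text \<open>Since \<open>Ls w\<close> lies in \<open>V\<close>, \<open>v\<close> may be replaced by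
  \<open>Pr v\<close> in the numerator; Cauchy-Schwarz then bounds every quotient by
  \<open>L2_norm S (Pr v) / L2_norm S v\<close>.\<close>

lemma inf_sup_projection_bound:
  assumes "v \<in> U"
    and "(INF v\<in>{v\<in>U. \<not> L2_zero S v}. SUP w\<in>{w\<in>Z. \<not> L2_zero S w}.
            \<bar>L2_inner S v (Ls w)\<bar> / (L2_norm S v * L2_norm S (Ls w))) \<ge> c"
  shows "c * L2_norm S v \<le> L2_norm S (Pr v)"
proof (cases "L2_zero S v")
  case True
  then have "L2_norm S v = 0" using assms(1) by (simp add: L2_zero_iff U_L2 L2_norm_def)
  then show ?thesis by simp
next
  case False
  let ?W = "{w\<in>Z. \<not> L2_zero S w}"
  let ?F = "\<lambda>v w. \<bar>L2_inner S v (Ls w)\<bar> / (L2_norm S v * L2_norm S (Ls w))"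
  obtain w0 where w0: "w0 \<in> ?W" using Z by (auto simp: discrete_space_def)
  \<comment> \<open>Real infima and suprema are informative only on bounded sets: the quotients are
    at most 1, hence the suprema are at least 0 and their infimum is a genuine lower bound.\<close>
  have F1: "?F v w \<le> 1" if "v \<in> U" "w \<in> ?W" for v w
    using L2_Cauchy_Schwarz[of v S "Ls w"] that by (auto simp: U_L2 Ls_L2 divide_le_eq_1 less_le)
  have "0 \<le> (SUP w\<in>?W. ?F v w)" if "v \<in> U" for v
  proof -
    have "0 \<le> ?F v w0" by simp
    also have "\<dots> \<le> (SUP w\<in>?W. ?F v w)"
      using F1[OF that] by (intro cSUP_upper w0 bdd_aboveI2)
    finally show ?thesis .
  qed
  then have "bdd_below ((\<lambda>v. SUP w\<in>?W. ?F v w) ` {v\<in>U. \<not> L2_zero S v})"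
    by (intro bdd_belowI2[of _ 0]) auto
  then have "c \<le> (SUP w\<in>?W. ?F v w)"
    using assms False by (intro order_trans[OF assms(2)] cINF_lower) auto
  also have "\<dots> \<le> L2_norm S (Pr v) / L2_norm S v"
  proof (rule cSUP_least)
    show "?W \<noteq> {}" using w0 by blast
    fix w assume w: "w \<in> ?W"
    have "\<bar>L2_inner S v (Ls w)\<bar> = \<bar>L2_inner S (Pr v) (Ls w)\<bar>"
      using w assms by (simp add: Pr_inner U_L2 Ls_in_V)
    also have "\<dots> \<le> L2_norm S (Pr v) * L2_norm S (Ls w)"
      using w assms by (intro L2_Cauchy_Schwarz) (auto simp: Pr_L2 U_L2 Ls_L2)
    finally have *: "\<bar>L2_inner S v (Ls w)\<bar> \<le> L2_norm S (Pr v) * L2_norm S (Ls w)" .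
    have "?F v w \<le> (L2_norm S (Pr v) * L2_norm S (Ls w)) / (L2_norm S v * L2_norm S (Ls w))"
      using * by (rule divide_right_mono) simp
    \<comment> \<open>An inequality also covers a vanishing \<open>L2_norm S (Ls w)\<close>, where
      the left side is 0 by the convention for division.\<close>
    also have "\<dots> \<le> L2_norm S (Pr v) / L2_norm S v" by simp
    finally show "?F v w \<le> L2_norm S (Pr v) / L2_norm S v" .
  qed
  finally have "c \<le> L2_norm S (Pr v) / L2_norm S v" .
  moreover have "0 < L2_norm S v"
    using False L2_inner_nonneg[of S v] assms(1) by (simp add: L2_zero_iff U_L2 L2_norm_def less_le)
  ultimately show ?thesis by (simp add: field_simps)
qed

lemma projection_variational_stability:
  assumes "projection_variational S Ls U Z u uh" "u \<in> L2_space S" "v \<in> U"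
  shows "L2_norm S (Pr (\<lambda>x. uh x - v x)) \<le> L2_norm S (\<lambda>x. v x - u x)"
proof -
  have uh: "uh \<in> U" and orth: "\<And>v. v \<in> U \<Longrightarrow> L2_inner S (Pr uh) v = L2_inner S (Pr u) v"
    using assms by (auto simp: projection_variational_def)
  let ?e = "\<lambda>x. uh x - v x"
  let ?r = "Pr ?e"
  have eU: "?e \<in> U" by (intro fun_subspace_diff U_subspace uh assms)
  note eL = U_L2[OF eU]
  note L2 = assms(2) U_L2[OF uh] U_L2[OF assms(3)] eL Pr_L2[OF eL]
  have rV: "?r \<in> V" using eL by (rule Pr_in_V)
  \<comment> \<open>Self-adjointness of the projection: both sides equal the inner product of
    \<open>Pr q\<close> and \<open>?r\<close>.\<close>
  have "L2_inner S q ?r = L2_inner S (Pr q) ?e" if q: "q \<in> L2_space S" for q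
    using Pr_inner[OF eL Pr_in_V[OF q]] Pr_inner[OF q rV] by (simp add: L2_inner_commute)
  then have "L2_inner S uh ?r = L2_inner S u ?r"
    using orth[OF eU] L2 by simp
  then have "(L2_norm S ?r)\<^sup>2 = L2_inner S (\<lambda>x. u x - v x) ?r"
    using Pr_inner[OF eL rV] L2 by (simp add: L2_norm_square L2_inner_diff_left)
  also have "\<dots> \<le> L2_norm S (\<lambda>x. u x - v x) * L2_norm S ?r"
    using L2_Cauchy_Schwarz[of "\<lambda>x. u x - v x" S ?r] L2 by simp
  finally have "L2_norm S ?r * L2_norm S ?r \<le> L2_norm S (\<lambda>x. v x - u x) * L2_norm S ?r"
    by (simp add: power2_eq_square L2_norm_minus_commute[of S u v])
  then show ?thesis
    using L2_norm_nonneg[of S ?r] L2_norm_nonneg[of S "\<lambda>x. v x - u x"]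
    by (cases "L2_norm S ?r = 0") (auto simp: mult_le_cancel_right)
qed

end

section \<open>Quasi-optimality from the inf-sup bound and the stability estimate\<close>

theorem theorem4p6:
  fixes \<Omega> :: "'a::euclidean_space set"
    and D :: "('a \<Rightarrow> real) set" and L :: "('a \<Rightarrow> real) \<Rightarrow> 'a \<Rightarrow> real"
    and cP cI :: real
    and U Z :: "('a \<Rightarrow> real) set"
    and f u uh :: "'a \<Rightarrow> real"
  assumes "open \<Omega>" and "connected \<Omega>" and "\<Omega> \<noteq> {}"
    and "linear_operator \<Omega> D L" and "densely_defined \<Omega> D" and "closed_operator \<Omega> D L"
    and "first_order_differential_operator \<Omega> D L"
    and "cP > 0"
    and "\<forall>w\<in>adj_dom \<Omega> D L. cP * L2_norm \<Omega> w \<le> L2_norm \<Omega> (adj \<Omega> D L w)"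
    and "\<forall>g\<in>L2_space \<Omega>. \<exists>w\<in>adj_dom \<Omega> D L. L2_eq \<Omega> (adj \<Omega> D L w) g"
    and "discrete_space \<Omega> D U"
    and "discrete_space \<Omega> (adj_dom \<Omega> D L) Z"
    and "cI > 0"
    and "(INF v\<in>{v\<in>U. \<not> L2_zero \<Omega> v}. SUP w\<in>{w\<in>Z. \<not> L2_zero \<Omega> w}.
            \<bar>L2_inner \<Omega> v (adj \<Omega> D L w)\<bar> / (L2_norm \<Omega> v * L2_norm \<Omega> (adj \<Omega> D L w))) \<ge> cI"
    and "f \<in> L2_space \<Omega>"
    and "u \<in> D" and "L2_eq \<Omega> (L u) f"
    and "LLstar_inv_solution \<Omega> L (adj \<Omega> D L) U Z f u uh"
  shows "L2_norm \<Omega> (\<lambda>x. uh x - u x) \<le> (1 + 1 / cI) * (INF v\<in>U. L2_norm \<Omega> (\<lambda>x. v x - u x))"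
proof -
  interpret LLstar_discretization \<Omega> D L U Z
    by unfold_locales (fact assms)+
  have uL: "u \<in> L2_space \<Omega>" by (rule dom_L2[OF \<open>u \<in> D\<close>])
  have pv: "projection_variational \<Omega> Ls U Z u uh"
    by (rule LLstar_inv_solution_imp) (fact assms)+
  then have uh: "uh \<in> U" by (simp add: projection_variational_def)
  \<comment> \<open>Dividing by the constant leaves a left side independent of \<open>v\<close>,
    that is, a lower bound for the infimum over the nonempty set \<open>U\<close>.\<close>
  have bound: "L2_norm \<Omega> (\<lambda>x. uh x - u x) / (1 + 1 / cI) \<le> L2_norm \<Omega> (\<lambda>x. v x - u x)"
    if v: "v \<in> U" for v
  proof -
    have eU: "(\<lambda>x. uh x - v x) \<in> U" by (intro fun_subspace_diff U_subspace uh v)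
    have "cI * L2_norm \<Omega> (\<lambda>x. uh x - v x) \<le> L2_norm \<Omega> (Pr (\<lambda>x. uh x - v x))"
      by (rule inf_sup_projection_bound[OF eU]) fact
    also have "\<dots> \<le> L2_norm \<Omega> (\<lambda>x. v x - u x)"
      by (rule projection_variational_stability[OF pv uL v])
    finally have "L2_norm \<Omega> (\<lambda>x. uh x - v x) \<le> L2_norm \<Omega> (\<lambda>x. v x - u x) / cI"
      using \<open>cI > 0\<close> by (simp add: field_simps)
    moreover have "L2_norm \<Omega> (\<lambda>x. uh x - u x)
        \<le> L2_norm \<Omega> (\<lambda>x. uh x - v x) + L2_norm \<Omega> (\<lambda>x. v x - u x)"
      using L2_norm_triangle[OF U_L2[OF eU], of "\<lambda>x. v x - u x"] uL U_L2[OF v] by simp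
    ultimately have "L2_norm \<Omega> (\<lambda>x. uh x - u x) \<le> (1 + 1 / cI) * L2_norm \<Omega> (\<lambda>x. v x - u x)"
      by (simp add: algebra_simps)
    moreover have "0 < 1 + 1 / cI" using \<open>cI > 0\<close> by (simp add: add_pos_pos)
    ultimately show ?thesis by (simp add: pos_divide_le_eq mult.commute)
  qed
  have "L2_norm \<Omega> (\<lambda>x. uh x - u x) / (1 + 1 / cI) \<le> (INF v\<in>U. L2_norm \<Omega> (\<lambda>x. v x - u x))"
    using uh bound by (intro cINF_greatest) auto
  moreover have "0 < 1 + 1 / cI" using \<open>cI > 0\<close> by (simp add: add_pos_pos)
  ultimately show ?thesis by (simp add: pos_divide_le_eq mult.commute)
qed

end
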